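(* Let $\mathcal{S}$ be a federated Byzantine quorum system over $\mathbf{V}$ with quorum intersection and let $(\mathcal{Q},\mathcal{B})$ be the dissemination quorum system it induces. Then Bracha broadcast over $(\mathcal{Q},\mathcal{B})$ satisfies the specification of reliable Byzantine broadcast (Validity, No duplication, Integrity, Consistency and Totality) in every execution in which at least one server in $\mathcal{S}$ is intact.
   Context: System model. There is a set of clients $\mathbf{C}$ and a disjoint finite non-empty set of servers $\mathbf{V}$. In an execution each node (client or server) is either correct (follows its protocol) or faulty (Byzantine: behaves arbitrarily). One distinguished client $c$ is the sender; it may be correct or faulty. Any two nodes communicate over an asynchronous point-to-point channel. If both endpoints are correct, the channel is authenticated and reliable: a correct node receives (eventually, after an arbitrary finite delay) a message from another correct node if and only if the latter sent it. Servers also send messages to themselves. Executions are complete: a handler of a correct server that stays enabled is eventually executed. A correct sender broadcasts at most one value. Federated Byzantine quorum system (FBQS) over $\mathbf{V}$: a function $\mathcal{S}$ assigning to each $v\in\mathbf{V}$ a non-empty set $\mathcal{S}(v)\subseteq 2^{\mathbf{V}}$ of quorum slices, with $v\in q$ for all $q\in\mathcal{S}(v)$. A non-empty $U\subseteq\mathbf{V}$ is a quorum in $\mathcal{S}$ if $\forall v\in U.\ \exists q\in\mathcal{S}(v).\ q\subseteq U$. $\mathcal{S}$ has quorum intersection if any two of its quorums intersect. For $I\subseteq\mathbf{V}$, $\mathcal{S}|_I$ is the FBQS over universe $I$ with $\mathcal{S}|_I(v)=\{q\cap I\mid q\in\mathcal{S}(v)\}$. Given a set of faulty servers $\mathbf{V}_{\mathrm{bad}}$,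 the set $\mathbf{V}_{\mathrm{int}}$ of intact servers in $\mathcal{S}$ is the biggest set such that $\mathbf{V}_{\mathrm{int}}\cap\mathbf{V}_{\mathrm{bad}}=\emptyset$; if $\mathbf{V}_{\mathrm{int}}$ is non-empty then it is a quorum in $\mathcal{S}$; and $\mathcal{S}|_{\mathbf{V}_{\mathrm{int}}}$ has quorum intersection. (For FBQSes with quorum intersection this set exists and is unique.) Induced DQS. $\mathcal{S}$ induces the pair $(\mathcal{Q},\mathcal{B})$ where $\mathcal{Q}$ is the set of all quorums in $\mathcal{S}$ and $\mathcal{B}$ consists of the inclusion-maximal sets $B\subseteq\mathbf{V}$ such that the set of intact servers in $\mathcal{S}$ with set of faulty servers $B$ is non-empty. This is a dissemination quorum system, i.e.: $\mathcal{Q}$ is non-empty, its elements are non-empty, pairwise intersecting, and closed under union; $\mathcal{B}$ is non-empty with no element contained in another; $\forall U_1,U_2\in\mathcal{Q}.\ \forall B\in\mathcal{B}.\ U_1\cap U_2\not\subseteq B$; and $\forall B\in\mathcal{B}.\ \exists U\in\mathcal{Q}.\ U\cap B=\emptyset$. Bracha broadcast over $(\mathcal{Q},\mathcal{B})$. To broadcast a value $a$, the sender $c$ sends $\mathtt{BCAST}(a)$ to every server. Each server has Boolean variables echoed, ready, delivered, all initially false, and the following handlers. (1) When it has received $\mathtt{BCAST}(a)$ from $c$ and echoed is false: set echoed to true and send $\mathtt{ECHO}(a)$ to every server. (2) When it has received $\mathtt{ECHO}(a)$ from every $u\in U$ for some $U\in\mathcal{Q}$, and ready is false: set ready to true and send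 $\mathtt{READY}(a)$ to every server. (3) When it has received $\mathtt{READY}(a)$ from every $u\in B$ for some non-empty $B\subseteq\mathbf{V}$ such that $B\not\subseteq B'$ for all $B'\in\mathcal{B}$, and ready is false: set ready to true and send $\mathtt{READY}(a)$ to every server. (4) When it has received $\mathtt{READY}(a)$ from every $u\in U$ for some $U\in\mathcal{Q}$, and delivered is false: set delivered to true and deliver $a$. Reliable Byzantine broadcast. Validity: if the sender is correct and broadcasts a value $a$, then every correct server eventually delivers $a$. No duplication: every correct server delivers at most one value. Integrity: if some correct server delivers a value $a$ and the sender is correct, then $a$ was previously broadcast by the sender. Consistency: if some correct server delivers $a$ and another correct server delivers $a'$, then $a=a'$. Totality: if a correct server delivers a value, then every correct server eventually delivers a value. *)

theory Defs
  imports Main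
begin

section \<open>Federated Byzantine quorum systems\<close>

definition fbqs :: "'n set \<Rightarrow> ('n \<Rightarrow> 'n set set) \<Rightarrow> bool" where
  "fbqs V S \<longleftrightarrow> (\<forall>v\<in>V. S v \<noteq> {} \<and> (\<forall>q\<in>S v. q \<subseteq> V \<and> v \<in> q))"

definition quorum :: "'n set \<Rightarrow> ('n \<Rightarrow> 'n set set) \<Rightarrow> 'n set \<Rightarrow> bool" where
  "quorum V S U \<longleftrightarrow> U \<noteq> {} \<and> U \<subseteq> V \<and> (\<forall>v\<in>U. \<exists>q\<in>S v. q \<subseteq> U)"

definition quorum_intersection :: "'n set \<Rightarrow> ('n \<Rightarrow> 'n set set) \<Rightarrow> bool" where
  "quorum_intersection V S \<longleftrightarrow>
     (\<forall>U1 U2. quorum V S U1 \<longrightarrow> quorum V S U2 \<longrightarrow> U1 \<inter> U2 \<noteq> {})"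

text \<open>The projection to \<open>I\<close> is to be read as an FBQS over the universe \<open>I\<close>; its
  values outside \<open>I\<close> are irrelevant.\<close>

definition project :: "('n \<Rightarrow> 'n set set) \<Rightarrow> 'n set \<Rightarrow> 'n \<Rightarrow> 'n set set" where
  "project S I v = {q \<inter> I | q. q \<in> S v}"

definition intact_candidate ::
    "'n set \<Rightarrow> ('n \<Rightarrow> 'n set set) \<Rightarrow> 'n set \<Rightarrow> 'n set \<Rightarrow> bool" where
  "intact_candidate V S Bad I \<longleftrightarrow>
     I \<subseteq> V \<and> I \<inter> Bad = {} \<and> (I \<noteq> {} \<longrightarrow> quorum V S I) \<and> quorum_intersection I (project S I)"

text \<open>The greatest candidate is with respect to set inclusion; it exists whenever \<open>V\<close> is finite
  and \<open>S\<close> has quorum intersection, see \<open>intact_candidate_intact\<close> below.\<close>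

definition intact :: "'n set \<Rightarrow> ('n \<Rightarrow> 'n set set) \<Rightarrow> 'n set \<Rightarrow> 'n set" where
  "intact V S Bad = (GREATEST I. intact_candidate V S Bad I)"


section \<open>Dissemination quorum systems\<close>

definition dissemination_quorum_system :: "'n set \<Rightarrow> 'n set set \<Rightarrow> 'n set set \<Rightarrow> bool" where
  "dissemination_quorum_system V Q B \<longleftrightarrow>
     Q \<noteq> {} \<and> (\<forall>U\<in>Q. U \<noteq> {} \<and> U \<subseteq> V) \<and>
     (\<forall>U1\<in>Q. \<forall>U2\<in>Q. U1 \<inter> U2 \<noteq> {} \<and> U1 \<union> U2 \<in> Q) \<and>
     B \<noteq> {} \<and> (\<forall>B1\<in>B. B1 \<subseteq> V) \<and> (\<forall>B1\<in>B. \<forall>B2\<in>B. B1 \<subseteq> B2 \<longrightarrow> B1 = B2) \<and>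
     (\<forall>U1\<in>Q. \<forall>U2\<in>Q. \<forall>B1\<in>B. \<not> U1 \<inter> U2 \<subseteq> B1) \<and>
     (\<forall>B1\<in>B. \<exists>U\<in>Q. U \<inter> B1 = {})"

definition induced_quorums :: "'n set \<Rightarrow> ('n \<Rightarrow> 'n set set) \<Rightarrow> 'n set set" where
  "induced_quorums V S = {U. quorum V S U}"

definition induced_fail_prone :: "'n set \<Rightarrow> ('n \<Rightarrow> 'n set set) \<Rightarrow> 'n set set" where
  "induced_fail_prone V S =
     {B. B \<subseteq> V \<and> intact V S B \<noteq> {} \<and>
         (\<forall>B'. B' \<subseteq> V \<and> intact V S B' \<noteq> {} \<and> B \<subseteq> B' \<longrightarrow> B' = B)}"

lemma quorum_union: "quorum V S A \<Longrightarrow> quorum V S B \<Longrightarrow> quorum V S (A \<union> B)"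
  unfolding quorum_def by (simp add: ball_Un) (meson sup.coboundedI1 sup.coboundedI2)

lemma quorum_project:
  assumes "quorum V S U" "U \<inter> I \<noteq> {}"
  shows "quorum I (project S I) (U \<inter> I)"
  unfolding quorum_def
proof (intro conjI ballI)
  fix v assume "v \<in> U \<inter> I"
  then obtain q where "q \<in> S v" "q \<subseteq> U"
    using assms(1) unfolding quorum_def by blast
  then show "\<exists>q\<in>project S I v. q \<subseteq> U \<inter> I"
    unfolding project_def by blast
qed (use assms(2) in auto)

lemma quorum_project_project:
  assumes "quorum J (project S J) U" "I \<subseteq> J" "U \<inter> I \<noteq> {}"
  shows "quorum I (project S I) (U \<inter> I)"
  unfolding quorum_def
proof (intro conjI ballI)
  fix v assume "v \<in> U \<inter> I"
  then obtain q where "q \<in> S v" "q \<inter> J \<subseteq> U"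
    using assms(1) unfolding quorum_def project_def by blast
  then show "\<exists>q\<in>project S I v. q \<subseteq> U \<inter> I"
    using assms(2) unfolding project_def by blast
qed (use assms(3) in auto)

lemma intact_candidate_empty: "intact_candidate V S Bad {}"
  unfolding intact_candidate_def quorum_intersection_def quorum_def by auto

lemma intact_candidate_union:
  assumes qi: "quorum_intersection V S"
    and X: "intact_candidate V S Bad X" and Y: "intact_candidate V S Bad Y"
  shows "intact_candidate V S Bad (X \<union> Y)"
proof (cases "X = {} \<or> Y = {}")
  case True
  then show ?thesis using X Y by auto
next
  case False
  then have qX: "quorum V S X" and qY: "quorum V S Y"
    using X Y unfolding intact_candidate_def by auto
  have XY: "X \<inter> Y \<noteq> {}"
    using qi qX qY unfolding quorum_intersection_def by blast
  have meetX: "U \<inter> X \<noteq> {}" if U: "quorum (X \<union> Y) (project S (X \<union> Y)) U" for U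
  proof
    assume no: "U \<inter> X = {}"
    have "U \<noteq> {}" "U \<subseteq> X \<union> Y" using U unfolding quorum_def by auto
    with no have "U \<inter> Y \<noteq> {}" by blast
    then have "quorum Y (project S Y) (U \<inter> Y)"
      using quorum_project_project[OF U] by blast
    moreover have "quorum Y (project S Y) (X \<inter> Y)"
      using quorum_project[OF qX XY] .
    ultimately have "(U \<inter> Y) \<inter> (X \<inter> Y) \<noteq> {}"
      using Y unfolding intact_candidate_def quorum_intersection_def by blast
    with no show False by blast
  qed
  have "quorum_intersection (X \<union> Y) (project S (X \<union> Y))"
    unfolding quorum_intersection_def
  proof (intro allI impI)
    fix U1 U2
    assume U1: "quorum (X \<union> Y) (project S (X \<union> Y)) U1"
      and U2: "quorum (X \<union> Y) (project S (X \<union> Y)) U2"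
    have "quorum X (project S X) (U1 \<inter> X)" "quorum X (project S X) (U2 \<inter> X)"
      using quorum_project_project[OF U1 _ meetX[OF U1]]
        quorum_project_project[OF U2 _ meetX[OF U2]] by auto
    then have "(U1 \<inter> X) \<inter> (U2 \<inter> X) \<noteq> {}"
      using X unfolding intact_candidate_def quorum_intersection_def by blast
    then show "U1 \<inter> U2 \<noteq> {}" by blast
  qed
  then show ?thesis
    using X Y quorum_union[OF qX qY] by (simp add: intact_candidate_def Int_Un_distrib2)
qed

lemma intact_candidate_intact:
  assumes fin: "finite V" and qi: "quorum_intersection V S"
  shows "intact_candidate V S Bad (intact V S Bad)"
    and "intact_candidate V S Bad I \<Longrightarrow> I \<subseteq> intact V S Bad"
proof -
  let ?P = "intact_candidate V S Bad"
  have "{I. ?P I} \<subseteq> Pow V" unfolding intact_candidate_def by auto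
  then have "finite {I. ?P I}" using fin by (meson finite_Pow_iff finite_subset)
  then obtain M where M: "?P M" "\<And>I. ?P I \<Longrightarrow> M \<subseteq> I \<Longrightarrow> M = I"
    using finite_has_maximal[of "{I. ?P I}"] intact_candidate_empty[of V S Bad] by blast
  have great: "I \<subseteq> M" if "?P I" for I
    using M(2)[OF intact_candidate_union[OF qi M(1) that]] by blast
  have "intact V S Bad = M"
    unfolding intact_def by (rule Greatest_equality) (use M(1) great in auto)
  then show "?P (intact V S Bad)" "?P I \<Longrightarrow> I \<subseteq> intact V S Bad"
    using M(1) great by auto
qed

lemma induced_dissemination_quorum_system:
  assumes "finite V" "V \<noteq> {}" "fbqs V S" "quorum_intersection V S"
  shows "dissemination_quorum_system V (induced_quorums V S) (induced_fail_prone V S)"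
proof -
  let ?Q = "induced_quorums V S" and ?B = "induced_fail_prone V S"
  note cand = intact_candidate_intact[OF assms(1,4)]
  have V: "quorum V S V"
    unfolding quorum_def
  proof (intro conjI ballI)
    fix v assume "v \<in> V"
    then have "S v \<noteq> {}" "\<forall>q\<in>S v. q \<subseteq> V" using assms(3) by (simp_all add: fbqs_def)
    then show "\<exists>q\<in>S v. q \<subseteq> V" by auto
  qed (use assms(2) in auto)
  have "quorum_intersection V (project S V)"
    unfolding quorum_intersection_def
  proof (intro allI impI)
    fix U1 U2 assume U: "quorum V (project S V) U1" "quorum V (project S V) U2"
    have "quorum V S W" if W: "quorum V (project S V) W" for W
      unfolding quorum_def
    proof (intro conjI ballI)
      fix v assume v: "v \<in> W"
      then obtain q where "q \<in> S v" "q \<inter> V \<subseteq> W" and "v \<in> V"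
        using W unfolding quorum_def project_def by blast
      moreover from this have "q \<subseteq> V" using assms(3) unfolding fbqs_def by blast
      ultimately show "\<exists>q\<in>S v. q \<subseteq> W" by (metis Int_absorb2)
    qed (use W in \<open>auto simp: quorum_def\<close>)
    then show "U1 \<inter> U2 \<noteq> {}"
      using U assms(4) unfolding quorum_intersection_def by blast
  qed
  then have "intact_candidate V S {} V"
    using V unfolding intact_candidate_def by auto
  then have int0: "intact V S {} \<noteq> {}"
    using cand(2)[of "{}" V] assms(2) by auto
  let ?T = "{B. B \<subseteq> V \<and> intact V S B \<noteq> {}}"
  have "finite ?T" using assms(1) by simp
  moreover have "{} \<in> ?T" using int0 by simp
  ultimately have "\<exists>M\<in>?T. \<forall>B\<in>?T. M \<subseteq> B \<longrightarrow> M = B"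
    by (intro finite_has_maximal) auto
  then obtain M where M: "M \<in> ?T" and max: "\<forall>B\<in>?T. M \<subseteq> B \<longrightarrow> M = B" ..
  have "B = M" if "B \<subseteq> V \<and> intact V S B \<noteq> {} \<and> M \<subseteq> B" for B
    using max[rule_format, of B] that by simp
  then have "M \<in> ?B"
    using M by (simp add: induced_fail_prone_def)
  then have B_ne: "?B \<noteq> {}" by auto
  have quo: "quorum V S (intact V S B)" "intact V S B \<inter> B = {}" if "B \<in> ?B" for B
    using cand(1)[of B] that unfolding intact_candidate_def induced_fail_prone_def by simp_all
  have cons: "\<not> U1 \<inter> U2 \<subseteq> B" if "U1 \<in> ?Q" "U2 \<in> ?Q" "B \<in> ?B" for U1 U2 B
  proof -
    let ?I = "intact V S B"
    have "quorum V S U1" "quorum V S U2"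
      using that(1,2) by (simp_all add: induced_quorums_def)
    moreover from this have "U1 \<inter> ?I \<noteq> {}" "U2 \<inter> ?I \<noteq> {}"
      using quo(1)[OF that(3)] assms(4) unfolding quorum_intersection_def by simp_all
    ultimately have "quorum ?I (project S ?I) (U1 \<inter> ?I)" "quorum ?I (project S ?I) (U2 \<inter> ?I)"
      by (simp_all add: quorum_project)
    moreover have "quorum_intersection ?I (project S ?I)"
      using cand(1)[of B] by (simp add: intact_candidate_def)
    ultimately have "(U1 \<inter> ?I) \<inter> (U2 \<inter> ?I) \<noteq> {}"
      unfolding quorum_intersection_def by simp
    then show ?thesis using quo(2)[OF that(3)] by blast
  qed
  have V_in: "V \<in> ?Q" using V by (simp add: induced_quorums_def)
  have Q_sub: "U \<noteq> {} \<and> U \<subseteq> V" if "U \<in> ?Q" for U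
    using that by (simp add: induced_quorums_def quorum_def)
  have Q_pair: "U1 \<inter> U2 \<noteq> {} \<and> U1 \<union> U2 \<in> ?Q" if "U1 \<in> ?Q" "U2 \<in> ?Q" for U1 U2
    using that assms(4) quorum_union[of V S U1 U2]
    by (simp add: induced_quorums_def quorum_intersection_def)
  have B_sub: "B \<subseteq> V" if "B \<in> ?B" for B
    using that by (simp add: induced_fail_prone_def)
  have B_max: "B1 = B2" if "B1 \<in> ?B" "B2 \<in> ?B" "B1 \<subseteq> B2" for B1 B2
    using that unfolding induced_fail_prone_def by simp
  have avail: "\<exists>U\<in>?Q. U \<inter> B = {}" if "B \<in> ?B" for B
    using quo[OF that] by (auto simp: induced_quorums_def)
  have Q_ne: "?Q \<noteq> {}" using V_in by auto
  show ?thesis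
    unfolding dissemination_quorum_system_def
    using Q_ne Q_sub Q_pair B_ne B_sub B_max cons avail by (intro conjI ballI impI) simp_all
qed


section \<open>Bracha broadcast\<close>

text \<open>Throughout, \<open>C\<close> is the set of clients, \<open>V\<close> the set of servers, \<open>c\<close> the sender, \<open>F\<close> the set
  of faulty nodes (clients and servers) and \<open>(Q, B)\<close> the dissemination quorum system.\<close>

datatype 'a msg = BCAST 'a | ECHO 'a | READY 'a

text \<open>An element \<open>(u, m)\<close> of \<open>received\<close> is a message \<open>m\<close> that arrived on the channel from \<open>u\<close>.\<close>

record ('n, 'a) server_state =
  echoed :: bool
  ready :: bool
  delivered :: bool
  received :: "('n \<times> 'a msg) set"

definition initial_server :: "('n, 'a) server_state" where
  "initial_server = \<lparr>echoed = False, ready = False, delivered = False, received = {}\<rparr>"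

text \<open>An element \<open>(u, v, m)\<close> of \<open>sent\<close> is a message \<open>m\<close> that \<open>u\<close> has sent to \<open>v\<close>. Since handlers
  only ask whether a message has been received, multiplicities are not recorded.\<close>

record ('n, 'a) config =
  server :: "'n \<Rightarrow> ('n, 'a) server_state"
  sent :: "('n \<times> 'n \<times> 'a msg) set"

definition received_from :: "('n, 'a) server_state \<Rightarrow> 'n set \<Rightarrow> 'a msg \<Rightarrow> bool" where
  "received_from s U m \<longleftrightarrow> (\<forall>u\<in>U. (u, m) \<in> received s)"

text \<open>The four handlers, in order: echo upon \<open>BCAST\<close>, become ready upon a quorum of \<open>ECHO\<close>s,
  become ready upon sufficiently many \<open>READY\<close>s, deliver upon a quorum of \<open>READY\<close>s.\<close>

datatype handler = Echo | Ready_by_Echo | Ready_by_Ready | Deliver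

fun guard :: "'n set \<Rightarrow> 'n \<Rightarrow> 'n set set \<Rightarrow> 'n set set \<Rightarrow>
    handler \<Rightarrow> 'a \<Rightarrow> ('n, 'a) server_state \<Rightarrow> bool" where
  "guard V c Q B Echo a s \<longleftrightarrow> (c, BCAST a) \<in> received s \<and> \<not> echoed s"
| "guard V c Q B Ready_by_Echo a s \<longleftrightarrow>
     (\<exists>U\<in>Q. received_from s U (ECHO a)) \<and> \<not> ready s"
| "guard V c Q B Ready_by_Ready a s \<longleftrightarrow>
     (\<exists>W. W \<noteq> {} \<and> W \<subseteq> V \<and> (\<forall>B'\<in>B. \<not> W \<subseteq> B') \<and> received_from s W (READY a)) \<and> \<not> ready s"
| "guard V c Q B Deliver a s \<longleftrightarrow>
     (\<exists>U\<in>Q. received_from s U (READY a)) \<and> \<not> delivered s"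

fun effect :: "handler \<Rightarrow> ('n, 'a) server_state \<Rightarrow> ('n, 'a) server_state" where
  "effect Echo s = s\<lparr>echoed := True\<rparr>"
| "effect Ready_by_Echo s = s\<lparr>ready := True\<rparr>"
| "effect Ready_by_Ready s = s\<lparr>ready := True\<rparr>"
| "effect Deliver s = s\<lparr>delivered := True\<rparr>"

fun emits :: "handler \<Rightarrow> 'a \<Rightarrow> 'a msg set" where
  "emits Echo a = {ECHO a}"
| "emits Ready_by_Echo a = {READY a}"
| "emits Ready_by_Ready a = {READY a}"
| "emits Deliver a = {}"

text \<open>\<open>Receive v u m\<close> is the arrival at \<open>v\<close> of \<open>m\<close> on the channel from \<open>u\<close>, and \<open>Handle v h a\<close> the
  execution of handler \<open>h\<close> at \<open>v\<close> for the value \<open>a\<close>. \<open>Idle\<close> makes finite executions infinite.\<close>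

datatype ('n, 'a) event =
    Broadcast 'a
  | Receive 'n 'n "'a msg"
  | Handle 'n handler 'a
  | Byzantine 'n
  | Idle

text \<open>A correct server accepts from a correct node only what that node has sent to it; what it
  receives from a faulty node is unconstrained. \<open>Broadcast\<close> is the protocol step of a correct
  sender; whatever a faulty sender does is covered by the rules for faulty nodes.\<close>

inductive step :: "'n set \<Rightarrow> 'n set \<Rightarrow> 'n \<Rightarrow> 'n set \<Rightarrow> 'n set set \<Rightarrow> 'n set set \<Rightarrow>
    ('n, 'a) config \<Rightarrow> ('n, 'a) event \<Rightarrow> ('n, 'a) config \<Rightarrow> bool"
  for C V c F Q B where
  broadcast:
    "c \<notin> F \<Longrightarrow>
     step C V c F Q B s (Broadcast a) (s\<lparr>sent := sent s \<union> {(c, v, BCAST a) | v. v \<in> V}\<rparr>)"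
| receive:
    "v \<in> V - F \<Longrightarrow> u \<in> C \<union> V \<Longrightarrow> u \<in> F \<or> (u, v, m) \<in> sent s \<Longrightarrow>
     step C V c F Q B s (Receive v u m)
       (s\<lparr>server := (server s)
            (v := (server s v)\<lparr>received := insert (u, m) (received (server s v))\<rparr>)\<rparr>)"
| handle:
    "v \<in> V - F \<Longrightarrow> guard V c Q B h a (server s v) \<Longrightarrow>
     step C V c F Q B s (Handle v h a)
       \<lparr>server = (server s)(v := effect h (server s v)),
        sent = sent s \<union> {(v, w, m) | w m. w \<in> V \<and> m \<in> emits h a}\<rparr>"
| byzantine:
    "u \<in> F \<Longrightarrow>
     step C V c F Q B s (Byzantine u)
       \<lparr>server = (server s)(u := st), sent = sent s \<union> {(u, w, m) | w m. (w, m) \<in> M}\<rparr>"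
| idle:
    "step C V c F Q B s Idle s"

text \<open>\<open>\<sigma> i\<close> is the configuration before the \<open>i\<close>-th event \<open>E i\<close>. The last three conjuncts say that
  a correct sender broadcasts at most one value, that channels between correct nodes are
  reliable, and that executions are complete.\<close>

definition execution :: "'n set \<Rightarrow> 'n set \<Rightarrow> 'n \<Rightarrow> 'n set \<Rightarrow> 'n set set \<Rightarrow> 'n set set \<Rightarrow>
    (nat \<Rightarrow> ('n, 'a) config) \<Rightarrow> (nat \<Rightarrow> ('n, 'a) event) \<Rightarrow> bool" where
  "execution C V c F Q B \<sigma> E \<longleftrightarrow>
     (\<forall>v\<in>V - F. server (\<sigma> 0) v = initial_server) \<and> sent (\<sigma> 0) = {} \<and>
     (\<forall>i. step C V c F Q B (\<sigma> i) (E i) (\<sigma> (Suc i))) \<and>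
     (\<forall>i j a a'. E i = Broadcast a \<longrightarrow> E j = Broadcast a' \<longrightarrow> a = a') \<and>
     (\<forall>i u v m. u \<notin> F \<longrightarrow> v \<in> V - F \<longrightarrow> (u, v, m) \<in> sent (\<sigma> i) \<longrightarrow>
        (\<exists>j. E j = Receive v u m)) \<and>
     (\<forall>i h a. \<forall>v\<in>V - F. (\<forall>j\<ge>i. guard V c Q B h a (server (\<sigma> j) v)) \<longrightarrow>
        (\<exists>j\<ge>i. E j = Handle v h a))"


section \<open>Reliable Byzantine broadcast\<close>

definition delivers_at :: "(nat \<Rightarrow> ('n, 'a) event) \<Rightarrow> 'n \<Rightarrow> 'a \<Rightarrow> nat \<Rightarrow> bool" where
  "delivers_at E v a i \<longleftrightarrow> E i = Handle v Deliver a"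

definition validity :: "'n set \<Rightarrow> 'n \<Rightarrow> 'n set \<Rightarrow> (nat \<Rightarrow> ('n, 'a) event) \<Rightarrow> bool" where
  "validity V c F E \<longleftrightarrow>
     (c \<notin> F \<longrightarrow> (\<forall>i a. E i = Broadcast a \<longrightarrow> (\<forall>v\<in>V - F. \<exists>j. delivers_at E v a j)))"

text \<open>At most one delivery event, hence in particular at most one delivered value.\<close>

definition no_duplication :: "'n set \<Rightarrow> 'n set \<Rightarrow> (nat \<Rightarrow> ('n, 'a) event) \<Rightarrow> bool" where
  "no_duplication V F E \<longleftrightarrow>
     (\<forall>v\<in>V - F. \<forall>i j a a'. delivers_at E v a i \<longrightarrow> delivers_at E v a' j \<longrightarrow> i = j)"

definition integrity :: "'n set \<Rightarrow> 'n \<Rightarrow> 'n set \<Rightarrow> (nat \<Rightarrow> ('n, 'a) event) \<Rightarrow> bool" where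
  "integrity V c F E \<longleftrightarrow>
     (\<forall>v\<in>V - F. \<forall>i a. delivers_at E v a i \<longrightarrow> c \<notin> F \<longrightarrow> (\<exists>j<i. E j = Broadcast a))"

definition consistency :: "'n set \<Rightarrow> 'n set \<Rightarrow> (nat \<Rightarrow> ('n, 'a) event) \<Rightarrow> bool" where
  "consistency V F E \<longleftrightarrow>
     (\<forall>v\<in>V - F. \<forall>v'\<in>V - F. \<forall>i j a a'.
        delivers_at E v a i \<longrightarrow> delivers_at E v' a' j \<longrightarrow> a = a')"

definition totality :: "'n set \<Rightarrow> 'n set \<Rightarrow> (nat \<Rightarrow> ('n, 'a) event) \<Rightarrow> bool" where
  "totality V F E \<longleftrightarrow>
     (\<forall>v\<in>V - F. \<forall>i a. delivers_at E v a i \<longrightarrow>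
        (\<forall>v'\<in>V - F. \<exists>a' j. delivers_at E v' a' j))"

definition reliable_byzantine_broadcast ::
    "'n set \<Rightarrow> 'n \<Rightarrow> 'n set \<Rightarrow> (nat \<Rightarrow> ('n, 'a) event) \<Rightarrow> bool" where
  "reliable_byzantine_broadcast V c F E \<longleftrightarrow>
     validity V c F E \<and> no_duplication V F E \<and> integrity V c F E \<and>
     consistency V F E \<and> totality V F E"

end

(* The faulty servers lie in some fail-prone set B0, so any two quorums meet in a correct server and
   some quorum U0 consists of correct servers only. Going back to the earliest READY(a) of a correct
   server, every READY(a) is backed by a quorum whose correct members echoed a; since a correct
   server echoes once, all correct servers are ready for the same value, which gives consistency and
   integrity. For totality, if U is the quorum of READY messages behind a delivery, then U \<inter> U0 is
   contained in no fail-prone set and consists of correct servers, so their READY messages make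
   every correct server ready, and then those of U0 make every correct server deliver. *)

theory Submission
  imports Defs
begin

text \<open>Each handler waits for one Boolean variable to be false and then sets it. Naming that
  variable lets "fires at most once" and "eventually fires" be proved uniformly for all four
  handlers. The two ready handlers share a variable, so handlers are compared below through their
  flags.\<close>

fun flag :: "handler \<Rightarrow> ('n, 'a) server_state \<Rightarrow> bool" where
  "flag Echo = echoed"
| "flag Ready_by_Echo = ready"
| "flag Ready_by_Ready = ready"
| "flag Deliver = delivered"

lemma guard_not_flag: "guard V c Q B h a s \<Longrightarrow> \<not> flag h s"
  by (cases h) auto

text \<open>The type constraint fixes the state type, which an equation between two selectors leaves
  open.\<close>

lemma flag_effect:
  "flag h (effect h' s) \<longleftrightarrow> flag h s \<or> flag h = (flag h' :: ('n, 'a) server_state \<Rightarrow> bool)"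
  for s :: "('n, 'a) server_state"
proof -
  have "(echoed :: ('n, 'a) server_state \<Rightarrow> bool) \<noteq> ready"
    "(echoed :: ('n, 'a) server_state \<Rightarrow> bool) \<noteq> delivered"
    "(ready :: ('n, 'a) server_state \<Rightarrow> bool) \<noteq> delivered"
    \<comment> \<open>Two selectors are told apart at a state where exactly one of them is
      true.\<close>
    using fun_cong[of echoed ready "initial_server\<lparr>echoed := True\<rparr>"]
      fun_cong[of echoed delivered "initial_server\<lparr>echoed := True\<rparr>"]
      fun_cong[of ready delivered "initial_server\<lparr>ready := True\<rparr>"]
    by (auto simp: initial_server_def)
  then show ?thesis by (cases h; cases h') auto
qed

lemma received_effect: "received (effect h s) = received s"
  by (cases h) auto

text \<open>The argument runs over an arbitrary dissemination quorum system with a fail-prone set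
  \<open>B0\<close> covering the faulty servers. Only \<open>F \<inter> V\<close> is bounded, so the
  sender, being a client, may be faulty.\<close>

locale bracha_execution =
  fixes C V F :: "'n set" and c :: 'n and Q B :: "'n set set" and B0 :: "'n set"
    and \<sigma> :: "nat \<Rightarrow> ('n, 'a) config" and E :: "nat \<Rightarrow> ('n, 'a) event"
  assumes finite_servers: "finite V"
    and disjoint: "C \<inter> V = {}"
    and sender: "c \<in> C"
    and dqs: "dissemination_quorum_system V Q B"
    and exec: "execution C V c F Q B \<sigma> E"
    and B0: "B0 \<in> B"
    and faulty: "F \<inter> V \<subseteq> B0"
begin

abbreviation st :: "nat \<Rightarrow> 'n \<Rightarrow> ('n, 'a) server_state" where
  "st i v \<equiv> server (\<sigma> i) v"

abbreviation fires :: "'n \<Rightarrow> handler \<Rightarrow> 'a \<Rightarrow> nat \<Rightarrow> bool" where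
  "fires v h a i \<equiv> E i = Handle v h a"

section \<open>Consequences of the execution and quorum axioms\<close>

lemmas exec_conjuncts = exec[unfolded execution_def]

lemma step_at: "step C V c F Q B (\<sigma> i) (E i) (\<sigma> (Suc i))"
  using exec_conjuncts by (elim conjE) (erule spec)

lemma init_server: "v \<in> V - F \<Longrightarrow> st 0 v = initial_server"
  using exec_conjuncts[THEN conjunct1] by (rule bspec)

lemma init_sent: "sent (\<sigma> 0) = {}"
  using exec_conjuncts by (elim conjE)

lemma channel:
  assumes "u \<notin> F" "v \<in> V - F" "(u, v, m) \<in> sent (\<sigma> i)"
  shows "\<exists>j. E j = Receive v u m"
proof -
  have "\<forall>i u v m. u \<notin> F \<longrightarrow> v \<in> V - F \<longrightarrow> (u, v, m) \<in> sent (\<sigma> i) \<longrightarrow>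
      (\<exists>j. E j = Receive v u m)"
    using exec_conjuncts by (elim conjE)
  with assms show ?thesis by blast
qed

lemma complete:
  assumes "v \<in> V - F" "\<And>j. j \<ge> i \<Longrightarrow> guard V c Q B h a (st j v)"
  shows "\<exists>j. fires v h a j"
proof -
  have "\<forall>i h a. \<forall>v\<in>V - F. (\<forall>j\<ge>i. guard V c Q B h a (st j v)) \<longrightarrow> (\<exists>j\<ge>i. fires v h a j)"
    using exec_conjuncts by (elim conjE)
  with assms show ?thesis by blast
qed

lemma broadcast_unique:
  assumes "E i = Broadcast a" "E j = Broadcast a'"
  shows "a = a'"
proof -
  have "\<forall>i j a a'. E i = Broadcast a \<longrightarrow> E j = Broadcast a' \<longrightarrow> a = a'"
    using exec_conjuncts by (elim conjE)
  with assms show ?thesis by blast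
qed

lemmas dqs_conjuncts = dqs[unfolded dissemination_quorum_system_def]

lemma quorum_servers: "U \<in> Q \<Longrightarrow> U \<subseteq> V"
  using dqs_conjuncts by simp

lemma quorums_not_within:
  assumes "U1 \<in> Q" "U2 \<in> Q" "B1 \<in> B"
  shows "\<not> U1 \<inter> U2 \<subseteq> B1"
proof -
  have "\<forall>U1\<in>Q. \<forall>U2\<in>Q. \<forall>B1\<in>B. \<not> U1 \<inter> U2 \<subseteq> B1"
    using dqs_conjuncts by (elim conjE)
  with assms show ?thesis by simp
qed

lemma correct_member: "W \<subseteq> V \<Longrightarrow> \<not> W \<subseteq> B0 \<Longrightarrow> \<exists>w\<in>W. w \<in> V - F"
  using faulty by blast

lemma quorums_share_correct:
  assumes "U1 \<in> Q" "U2 \<in> Q"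
  shows "\<exists>u\<in>U1 \<inter> U2. u \<in> V - F"
proof (rule correct_member)
  show "U1 \<inter> U2 \<subseteq> V" using quorum_servers[OF assms(1)] by auto
  show "\<not> U1 \<inter> U2 \<subseteq> B0" using quorums_not_within[OF assms B0] .
qed

lemma correct_quorum: "\<exists>U\<in>Q. U \<subseteq> V - F"
proof -
  have "\<forall>B1\<in>B. \<exists>U\<in>Q. U \<inter> B1 = {}"
    using dqs_conjuncts by (elim conjE)
  then obtain U where "U \<in> Q" "U \<inter> B0 = {}"
    using B0 by auto
  with faulty quorum_servers[of U] have "U \<subseteq> V - F" by auto
  with \<open>U \<in> Q\<close> show ?thesis ..
qed

section \<open>Flags and received messages of correct servers over time\<close>

lemma fires_step:
  assumes "fires v h a i"
  shows "v \<in> V - F" "guard V c Q B h a (st i v)" "st (Suc i) v = effect h (st i v)"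
    "w \<in> V \<Longrightarrow> m \<in> emits h a \<Longrightarrow> (v, w, m) \<in> sent (\<sigma> (Suc i))"
  using step_at[of i] unfolding assms by (cases; auto)+

text \<open>Receipt changes only \<open>received\<close>, and Byzantine steps overwrite only faulty
  nodes, so handlers alone act on flags. One direction gives persistence of flags, the other traces
  a raised flag to a firing.\<close>

lemma flag_step:
  assumes "v \<in> V - F"
  shows "flag h (st (Suc i) v) \<longleftrightarrow>
    flag h (st i v) \<or> (\<exists>h' a. fires v h' a i \<and> flag h' = (flag h :: ('n, 'a) server_state \<Rightarrow> bool))"
  using step_at[of i]
proof cases
  case (receive v' u m)
  then show ?thesis by (cases h) auto
next
  case (handle v' h' a)
  then show ?thesis by (auto simp: flag_effect)
qed (use assms in auto)

lemma received_step: "v \<in> V - F \<Longrightarrow> received (st i v) \<subseteq> received (st (Suc i) v)"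
  using step_at[of i] by cases (auto simp: received_effect)

lemma received_mono:
  assumes "v \<in> V - F" "i \<le> j"
  shows "received (st i v) \<subseteq> received (st j v)"
  by (rule lift_Suc_mono_le[where f = "\<lambda>i. received (st i v)"]) (use received_step assms in auto)

lemma flag_mono:
  assumes "v \<in> V - F" "flag h (st i v)" "i \<le> j"
  shows "flag h (st j v)"
  using assms(3,2) by (induction rule: dec_induct) (use flag_step[OF assms(1)] in auto)

lemma flag_fired:
  assumes "v \<in> V - F" "flag h (st i v)"
  shows "\<exists>j h' a. fires v h' a j \<and> flag h' = (flag h :: ('n, 'a) server_state \<Rightarrow> bool)"
  using assms(2)
proof (induction i)
  case 0
  then show ?case using init_server[OF assms(1)] by (cases h) (auto simp: initial_server_def)
next
  case (Suc i)
  then show ?case using flag_step[OF assms(1)] by blast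
qed

text \<open>A firing raises its flag for good, while every guard demands the flag down. As only
  flags are compared, this also excludes firing both ready handlers at one server.\<close>

lemma fires_unique:
  assumes "fires v h a i" "fires v h' a' j"
    and "flag h = (flag h' :: ('n, 'a) server_state \<Rightarrow> bool)"
  shows "i = j"
proof -
  have no: "\<not> i < j"
    if "fires v h a i" "fires v h' a' j" "flag h = (flag h' :: ('n, 'a) server_state \<Rightarrow> bool)"
    for h h' a a' i j
  proof
    assume "i < j"
    have "flag h (st (Suc i) v)" using fires_step(3)[OF that(1)] by (simp add: flag_effect)
    then have "flag h' (st j v)"
      using flag_mono[OF fires_step(1)[OF that(1)]] \<open>i < j\<close> that(3) by (metis Suc_leI)
    then show False using guard_not_flag[OF fires_step(2)[OF that(2)]] by simp
  qed
  show ?thesis using no[OF assms] no[OF assms(2,1)] assms(3) by auto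
qed

text \<open>Either the flag is raised at some time, hence by some firing, or it stays down and
  completeness applies to the permanently enabled handler. In the first case another value, or the
  other ready handler, may have come first; callers must identify the value themselves.\<close>

lemma eventually_fires:
  assumes "v \<in> V - F" "\<And>j. j \<ge> i \<Longrightarrow> \<not> flag h (st j v) \<Longrightarrow> guard V c Q B h a (st j v)"
  shows "\<exists>j h' a'. fires v h' a' j \<and> flag h' = (flag h :: ('n, 'a) server_state \<Rightarrow> bool)"
proof (cases "\<exists>j. flag h (st j v)")
  case True
  then show ?thesis using flag_fired[OF assms(1)] by blast
next
  case False
  then show ?thesis using complete[OF assms(1)] assms(2) by blast
qed

section \<open>Tracing messages between correct nodes\<close>

lemma received_sent:
  assumes "v \<in> V - F" "u \<notin> F" "(u, m) \<in> received (st i v)"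
  shows "(u, v, m) \<in> sent (\<sigma> i)"
  using assms(3)
proof (induction i)
  case 0
  then show ?case using init_server[OF assms(1)] by (simp add: initial_server_def)
next
  case (Suc i)
  from step_at[of i] show ?case
    by cases (use Suc assms(1,2) in \<open>auto simp: received_effect split: if_splits\<close>)
qed

text \<open>The strict bound \<open>j<i\<close> is what later permits induction on time.\<close>

lemma sent_by_server:
  assumes "u \<in> V - F" "(u, v, m) \<in> sent (\<sigma> i)"
  shows "\<exists>j<i. \<exists>h a. fires u h a j \<and> m \<in> emits h a"
  using assms(2)
proof (induction i)
  case 0
  then show ?case by (simp add: init_sent)
next
  case (Suc i)
  \<comment> \<open>The sender is a client, so the \<open>broadcast\<close> rule never accounts for
    a message of a server.\<close>
  have "u \<noteq> c" using assms(1) sender disjoint by auto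
  with step_at[of i] Suc.prems assms(1)
  have "(u, v, m) \<in> sent (\<sigma> i) \<or> (\<exists>h a. fires u h a i \<and> m \<in> emits h a)"
    by cases auto
  then show ?case using Suc.IH less_Suc_eq by blast
qed

lemma sent_by_sender:
  assumes "c \<notin> F" "(c, v, BCAST a) \<in> sent (\<sigma> i)"
  shows "\<exists>j<i. E j = Broadcast a"
  using assms(2)
proof (induction i)
  case 0
  then show ?case by (simp add: init_sent)
next
  case (Suc i)
  \<comment> \<open>Conversely, the sender runs no handler.\<close>
  have "c \<notin> V" using sender disjoint by auto
  with step_at[of i] Suc.prems assms(1)
  have "(c, v, BCAST a) \<in> sent (\<sigma> i) \<or> E i = Broadcast a"
    by cases auto
  then show ?case using Suc.IH less_Suc_eq by blast
qed

lemma received_by_fires: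
  assumes "v \<in> V - F" "u \<in> V - F" "(u, m) \<in> received (st i v)"
  shows "\<exists>j<i. \<exists>h a. fires u h a j \<and> m \<in> emits h a"
  using sent_by_server[OF assms(2) received_sent[OF assms(1) _ assms(3)]] assms(2) by simp

lemma sent_received:
  assumes "u \<notin> F" "v \<in> V - F" "(u, v, m) \<in> sent (\<sigma> i)"
  shows "\<exists>j. (u, m) \<in> received (st j v)"
proof -
  obtain j where j: "E j = Receive v u m" using channel[OF assms] by blast
  from step_at[of j] have "(u, m) \<in> received (st (Suc j) v)"
    unfolding j by cases auto
  then show ?thesis by blast
qed

text \<open>Receipt is permanent and \<open>U\<close> is finite, so the latest of the individual
  receipt times serves for all of \<open>U\<close>.\<close>

lemma eventually_received_from:
  assumes "U \<subseteq> V - F" "v \<in> V - F"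
    and "\<And>u. u \<in> U \<Longrightarrow> \<exists>i h a. fires u h a i \<and> m \<in> emits h a"
  shows "\<exists>i. \<forall>j\<ge>i. received_from (st j v) U m"
proof -
  have "\<exists>i. (u, m) \<in> received (st i v)" if u: "u \<in> U" for u
  proof -
    obtain i h a where "fires u h a i" "m \<in> emits h a" using assms(3)[OF u] by auto
    then have "(u, v, m) \<in> sent (\<sigma> (Suc i))" using fires_step(4) assms(2) by simp
    moreover have "u \<notin> F" using assms(1) u by auto
    ultimately show ?thesis using sent_received[OF _ assms(2)] by simp
  qed
  then obtain t where t: "(u, m) \<in> received (st (t u) v)" if "u \<in> U" for u
    by metis
  have "finite U" using assms(1) finite_servers by (meson finite_Diff finite_subset)
  then have le: "t u \<le> Max (t ` U)" if "u \<in> U" for u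
    using that by simp
  have "received_from (st j v) U m" if "j \<ge> Max (t ` U)" for j
    unfolding received_from_def
  proof
    fix u assume u: "u \<in> U"
    have "t u \<le> j" using le[OF u] that by simp
    from subsetD[OF received_mono[OF assms(2) this] t[OF u]] show "(u, m) \<in> received (st j v)" .
  qed
  then show ?thesis by blast
qed

section \<open>The value for which correct servers become ready\<close>

definition readies :: "'n \<Rightarrow> 'a \<Rightarrow> nat \<Rightarrow> bool" where
  "readies v a i \<longleftrightarrow> fires v Ready_by_Echo a i \<or> fires v Ready_by_Ready a i"

lemma emits_ECHO: "ECHO a \<in> emits h b \<longleftrightarrow> h = Echo \<and> b = a"
  by (cases h) auto

lemma emits_READY: "READY a \<in> emits h b \<longleftrightarrow> (h = Ready_by_Echo \<or> h = Ready_by_Ready) \<and> b = a"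
  by (cases h) auto

text \<open>All flags are down in the initial state, so there \<open>flag_effect\<close> turns
  equality of flags into a Boolean computation.\<close>

lemma flag_eq_Echo: "flag h = (echoed :: ('n, 'a) server_state \<Rightarrow> bool) \<longleftrightarrow> h = Echo"
  using flag_effect[of Echo h "initial_server :: ('n, 'a) server_state"]
  by (cases h) (auto simp: initial_server_def)

lemma flag_eq_ready:
  "flag h = (ready :: ('n, 'a) server_state \<Rightarrow> bool) \<longleftrightarrow> h = Ready_by_Echo \<or> h = Ready_by_Ready"
  using flag_effect[of Ready_by_Echo h "initial_server :: ('n, 'a) server_state"]
  by (cases h) (auto simp: initial_server_def)

lemma flag_eq_Deliver: "flag h = (delivered :: ('n, 'a) server_state \<Rightarrow> bool) \<longleftrightarrow> h = Deliver"
  using flag_effect[of Deliver h "initial_server :: ('n, 'a) server_state"]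
  by (cases h) (auto simp: initial_server_def)

text \<open>Strong induction on time with the server varying: a firing of
  \<open>Ready_by_Ready\<close> rests on a correct server that became ready strictly earlier, so the
  descent ends at a firing of \<open>Ready_by_Echo\<close>.\<close>

lemma readies_echo_quorum:
  assumes "v \<in> V - F" "readies v a i"
  shows "\<exists>U\<in>Q. \<forall>u\<in>U \<inter> (V - F). \<exists>j<i. fires u Echo a j"
  using assms
proof (induction i arbitrary: v rule: less_induct)
  case (less i)
  from less.prems(2) consider "fires v Ready_by_Echo a i" | "fires v Ready_by_Ready a i"
    unfolding readies_def by blast
  then show ?case
  proof cases
    case 1
    obtain U where U: "U \<in> Q" "received_from (st i v) U (ECHO a)"
      using fires_step(2)[OF 1] by auto
    have "\<exists>j<i. fires u Echo a j" if "u \<in> U \<inter> (V - F)" for u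
      using received_by_fires[OF less.prems(1), of u "ECHO a" i] U(2) that
      unfolding received_from_def emits_ECHO by blast
    with U(1) show ?thesis by blast
  next
    case 2
    obtain W where W: "W \<subseteq> V" "\<forall>B'\<in>B. \<not> W \<subseteq> B'" "received_from (st i v) W (READY a)"
      using fires_step(2)[OF 2] by auto
    \<comment> \<open>A set inside no fail-prone set is not inside \<open>B0\<close>, hence has a
      correct member.\<close>
    obtain w where w: "w \<in> W" "w \<in> V - F"
      using correct_member[OF W(1)] W(2) B0 by blast
    obtain j where j: "j < i" "readies w a j"
      using received_by_fires[OF less.prems(1) w(2), of "READY a" i] W(3) w(1)
      unfolding received_from_def emits_READY readies_def by blast
    obtain U where "U \<in> Q" "\<forall>u\<in>U \<inter> (V - F). \<exists>k<j. fires u Echo a k"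
      using less.IH[OF j(1) w(2) j(2)] by blast
    then show ?thesis using j(1) by (meson less_trans)
  qed
qed

text \<open>A quorum intersected with itself already contains a correct server.\<close>

lemma readies_echo:
  assumes "v \<in> V - F" "readies v a i"
  shows "\<exists>u\<in>V - F. \<exists>j<i. fires u Echo a j"
  using readies_echo_quorum[OF assms] quorums_share_correct by (meson IntD1 IntI)

lemma readies_agree:
  assumes "v \<in> V - F" "readies v a i" "v' \<in> V - F" "readies v' a' i'"
  shows "a = a'"
proof -
  obtain U where U: "U \<in> Q" "\<And>u. u \<in> U \<inter> (V - F) \<Longrightarrow> \<exists>j<i. fires u Echo a j"
    using readies_echo_quorum[OF assms(1,2)] by blast
  obtain U' where U': "U' \<in> Q" "\<And>u. u \<in> U' \<inter> (V - F) \<Longrightarrow> \<exists>j<i'. fires u Echo a' j"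
    using readies_echo_quorum[OF assms(3,4)] by blast
  obtain u where "u \<in> U \<inter> U'" "u \<in> V - F"
    using quorums_share_correct[OF U(1) U'(1)] by blast
  then obtain j j' where j: "fires u Echo a j" "fires u Echo a' j'"
    using U(2)[of u] U'(2)[of u] by blast
  \<comment> \<open>Both echoes are the same event, which carries a single value.\<close>
  with fires_unique[OF j] show ?thesis by simp
qed

lemma delivers_quorum:
  assumes "v \<in> V - F" "delivers_at E v a i"
  shows "\<exists>U\<in>Q. \<forall>u\<in>U \<inter> (V - F). \<exists>j<i. readies u a j"
proof -
  obtain U where U: "U \<in> Q" "received_from (st i v) U (READY a)"
    using fires_step(2)[OF assms(2)[unfolded delivers_at_def]] by auto
  have "\<exists>j<i. readies u a j" if "u \<in> U \<inter> (V - F)" for u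
    using received_by_fires[OF assms(1), of u "READY a" i] U(2) that
    unfolding received_from_def emits_READY readies_def by blast
  with U(1) show ?thesis by blast
qed

lemma delivers_ready:
  assumes "v \<in> V - F" "delivers_at E v a i"
  shows "\<exists>u\<in>V - F. \<exists>j<i. readies u a j"
  using delivers_quorum[OF assms] quorums_share_correct by (meson IntD1 IntI)

section \<open>From broadcast to delivery: the five properties\<close>

lemma echo_broadcast:
  assumes "c \<notin> F" "fires v Echo a i"
  shows "\<exists>j<i. E j = Broadcast a"
  using fires_step(1,2)[OF assms(2)] received_sent[OF _ assms(1)] sent_by_sender[OF assms(1)]
  by (metis guard.simps(1))

text \<open>The common last stage of validity and totality: a quorum of correct servers supplies the
  READY messages that enable \<open>Deliver\<close>.\<close>

lemma all_ready_deliver: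
  assumes ready: "\<And>u. u \<in> V - F \<Longrightarrow> \<exists>i. readies u a i" and v: "v \<in> V - F"
  shows "\<exists>i. delivers_at E v a i"
proof -
  obtain U where U: "U \<in> Q" "U \<subseteq> V - F" using correct_quorum by blast
  have "\<exists>i h b. fires u h b i \<and> READY a \<in> emits h b" if "u \<in> U" for u
    using ready[of u] U(2) that unfolding readies_def emits_READY by blast
  then obtain i where i: "\<forall>j\<ge>i. received_from (st j v) U (READY a)"
    using eventually_received_from[OF U(2) v] by blast
  have "\<exists>j h b. fires v h b j \<and> flag h = (flag Deliver :: ('n, 'a) server_state \<Rightarrow> bool)"
    by (rule eventually_fires[OF v, of i _ a]) (use i U(1) in auto)
  then obtain j b where j: "delivers_at E v b j"
    unfolding flag.simps flag_eq_Deliver delivers_at_def by blast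
  \<comment> \<open>Some value \<open>b\<close> is delivered; a correct server was ready for
    \<open>b\<close>, and \<open>v\<close> itself is ready for \<open>a\<close>.\<close>
  have "b = a"
    using delivers_ready[OF v j] ready[OF v] readies_agree v by metis
  with j show ?thesis by blast
qed

lemma validity: "validity V c F E"
  unfolding validity_def
proof (intro impI allI ballI)
  fix i a v assume c: "c \<notin> F" and bc: "E i = Broadcast a" and v: "v \<in> V - F"
  have echo: "\<exists>j. fires u Echo a j" if u: "u \<in> V - F" for u
  proof -
    from step_at[of i] have "(c, u, BCAST a) \<in> sent (\<sigma> (Suc i))"
      unfolding bc using u by cases auto
    then obtain k where k: "(c, BCAST a) \<in> received (st k u)"
      using sent_received[OF c u] by blast
    have "\<exists>j h b. fires u h b j \<and> flag h = (flag Echo :: ('n, 'a) server_state \<Rightarrow> bool)"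
      by (rule eventually_fires[OF u, of k _ a]) (use k received_mono[OF u] in auto)
    then obtain j b where j: "fires u Echo b j"
      unfolding flag.simps flag_eq_Echo by blast
    \<comment> \<open>Whatever was echoed goes back to the correct sender, which broadcasts only one
      value.\<close>
    then have "b = a" using echo_broadcast[OF c j] broadcast_unique[OF bc] by blast
    with j show ?thesis by blast
  qed
  obtain U where U: "U \<in> Q" "U \<subseteq> V - F" using correct_quorum by blast
  have ready: "\<exists>j. readies u a j" if u: "u \<in> V - F" for u
  proof -
    have "\<exists>j h b. fires w h b j \<and> ECHO a \<in> emits h b" if "w \<in> U" for w
      using echo[of w] U(2) that unfolding emits_ECHO by blast
    then obtain k where k: "\<forall>j\<ge>k. received_from (st j u) U (ECHO a)"
      using eventually_received_from[OF U(2) u] by blast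
    have "\<exists>j h b. fires u h b j \<and> flag h = (flag Ready_by_Echo :: ('n, 'a) server_state \<Rightarrow> bool)"
      by (rule eventually_fires[OF u, of k _ a]) (use k U(1) in auto)
    then obtain j b where j: "readies u b j"
      unfolding flag.simps flag_eq_ready readies_def by blast
    \<comment> \<open>The value \<open>b\<close> goes back to an echo, and thence to the
      broadcast.\<close>
    obtain w l where "fires w Echo b l" using readies_echo[OF u j] by blast
    then have "b = a" using echo_broadcast[OF c] broadcast_unique[OF bc] by blast
    with j show ?thesis by blast
  qed
  show "\<exists>j. delivers_at E v a j" by (rule all_ready_deliver[OF ready v])
qed

lemma no_duplication: "no_duplication V F E"
  unfolding no_duplication_def delivers_at_def using fires_unique[OF _ _ refl] by simp

text \<open>Delivery, readiness, echo and broadcast form a chain of strictly decreasing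
  times.\<close>

lemma integrity: "integrity V c F E"
  unfolding integrity_def
proof (intro ballI allI impI)
  fix v i a assume v: "v \<in> V - F" and d: "delivers_at E v a i" and c: "c \<notin> F"
  obtain u j where u: "u \<in> V - F" "j < i" "readies u a j" using delivers_ready[OF v d] by blast
  obtain w k where w: "k < j" "fires w Echo a k" using readies_echo[OF u(1,3)] by blast
  show "\<exists>j<i. E j = Broadcast a"
    using echo_broadcast[OF c w(2)] w(1) u(2) by (meson less_trans)
qed

lemma consistency: "consistency V F E"
  unfolding consistency_def
proof (intro ballI allI impI)
  fix v v' i j a a'
  assume v: "v \<in> V - F" "v' \<in> V - F" and d: "delivers_at E v a i" "delivers_at E v' a' j"
  obtain u k where u: "u \<in> V - F" "readies u a k" using delivers_ready[OF v(1) d(1)] by blast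
  obtain u' k' where u': "u' \<in> V - F" "readies u' a' k'"
    using delivers_ready[OF v(2) d(2)] by blast
  show "a = a'" by (rule readies_agree[OF u u'])
qed

lemma totality: "totality V F E"
  unfolding totality_def
proof (intro ballI allI impI)
  fix v i a v' assume v: "v \<in> V - F" and d: "delivers_at E v a i" and v': "v' \<in> V - F"
  obtain U where U: "U \<in> Q" "\<And>u. u \<in> U \<inter> (V - F) \<Longrightarrow> \<exists>j<i. readies u a j"
    using delivers_quorum[OF v d] by blast
  obtain U0 where U0: "U0 \<in> Q" "U0 \<subseteq> V - F" using correct_quorum by blast
  let ?W = "U \<inter> U0"
  have W: "?W \<subseteq> V - F" "\<forall>B'\<in>B. \<not> ?W \<subseteq> B'"
    using U0(2) quorums_not_within[OF U(1) U0(1)] by auto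
  \<comment> \<open>The empty set would lie inside \<open>B0\<close>.\<close>
  have W_ne: "?W \<noteq> {}" using W(2) B0 by (metis empty_subsetI)
  have ready: "\<exists>j. readies u a j" if u: "u \<in> V - F" for u
  proof -
    have "\<exists>j h b. fires w h b j \<and> READY a \<in> emits h b" if "w \<in> ?W" for w
      using U(2)[of w] W(1) that unfolding emits_READY readies_def by blast
    then obtain k where k: "\<forall>j\<ge>k. received_from (st j u) ?W (READY a)"
      using eventually_received_from[OF W(1) u] by blast
    \<comment> \<open>The witness for the existential in the guard is \<open>?W\<close>.\<close>
    have "guard V c Q B Ready_by_Ready a (st j u)"
      if "j \<ge> k" "\<not> flag Ready_by_Ready (st j u)" for j
      unfolding guard.simps
    proof (intro conjI exI)
      show "\<not> ready (st j u)" using that(2) by simp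
      show "?W \<noteq> {}" "?W \<subseteq> V" "\<forall>B'\<in>B. \<not> ?W \<subseteq> B'" using W W_ne by auto
      show "received_from (st j u) ?W (READY a)" using k that(1) by simp
    qed
    then have "\<exists>j h b. fires u h b j \<and> flag h = (flag Ready_by_Ready :: ('n, 'a) server_state \<Rightarrow> bool)"
      by (rule eventually_fires[OF u])
    then obtain j b where j: "readies u b j"
      unfolding flag.simps flag_eq_ready readies_def by blast
    \<comment> \<open>The delivery of \<open>a\<close> at \<open>v\<close> rests on a correct server
      ready for \<open>a\<close>, which fixes \<open>b\<close>.\<close>
    obtain w l where "w \<in> V - F" "readies w a l" using delivers_ready[OF v d] by blast
    then have "b = a" using readies_agree[OF u j] by blast
    with j show ?thesis by blast
  qed
  show "\<exists>a' j. delivers_at E v' a' j" using all_ready_deliver[OF ready v'] by blast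
qed

lemma reliable_byzantine_broadcast: "reliable_byzantine_broadcast V c F E"
  unfolding reliable_byzantine_broadcast_def
  by (intro conjI validity no_duplication integrity consistency totality)

end

section \<open>From an intact server to a covering fail-prone set\<close>

lemma fail_prone_extension:
  assumes "finite V" "X \<subseteq> V" "intact V S X \<noteq> {}"
  shows "\<exists>B0\<in>induced_fail_prone V S. X \<subseteq> B0"
proof -
  let ?T = "{X. X \<subseteq> V \<and> intact V S X \<noteq> {}}"
  have "finite ?T" using assms(1) by simp
  moreover have "X \<in> ?T" using assms(2,3) by simp
  ultimately obtain M where M: "M \<in> ?T" "X \<subseteq> M" "\<forall>Y\<in>?T. M \<subseteq> Y \<longrightarrow> M = Y"
    \<comment> \<open>Fail-prone sets are the maximal members of \<open>?T\<close>; as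
      \<open>?T\<close> is finite, one of them lies above \<open>X\<close>.\<close>
    using finite_has_maximal2[of ?T X] by auto
  have "M \<in> induced_fail_prone V S"
    unfolding induced_fail_prone_def using M(1,3) by auto
  with M(2) show ?thesis ..
qed

theorem corollary11:
  fixes C V F :: "'n set" and c :: 'n and S :: "'n \<Rightarrow> 'n set set"
    and \<sigma> :: "nat \<Rightarrow> ('n, 'a) config" and E :: "nat \<Rightarrow> ('n, 'a) event"
  assumes "finite V" and "V \<noteq> {}" and "C \<inter> V = {}" and "c \<in> C"
    and "fbqs V S" and "quorum_intersection V S"
    and "F \<subseteq> C \<union> V"
    and "execution C V c F (induced_quorums V S) (induced_fail_prone V S) \<sigma> E"
    and "intact V S (F \<inter> V) \<noteq> {}"
  shows "reliable_byzantine_broadcast V c F E"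
proof -
  \<comment> \<open>The existence of an intact server puts \<open>F \<inter> V\<close> among the
    sets that extend to a fail-prone one.\<close>
  obtain B0 where "B0 \<in> induced_fail_prone V S" "F \<inter> V \<subseteq> B0"
    using fail_prone_extension[OF assms(1) _ assms(9)] by blast
  then interpret bracha_execution C V F c "induced_quorums V S" "induced_fail_prone V S" B0 \<sigma> E
    using assms induced_dissemination_quorum_system[OF assms(1,2,5,6)] by unfold_locales
  show ?thesis by (rule reliable_byzantine_broadcast)
qed

end
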